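(* Let $\Delta x,\Delta t>0$ and $\lambda,\nu\in\mathbb{R}$. Consider the scheme $\widetilde{\mathcal A}(\lambda,\nu)=0$ for the KdV equation $\mathcal A\equiv u_t+uu_x+u_{xxx}=0$, where $$\widetilde{\mathcal A}(\lambda,\nu)=D_m\left(\widetilde{F_1}\right)+D_n\left(\widetilde{G_1}\right),\qquad \widetilde{G_1}=u_{0,0},$$ $$\widetilde{F_1}=\frac{(\mu_nu_{-1,0})^2+(\mu_nu_{0,0})^2+(\mu_nu_{-1,0})(\mu_nu_{0,0})}{6}+\mu_nD_m^2\mu_mu_{-2,0}+D_nD_m\left(\lambda u_{-1,0}+\nu D_m^2u_{-2,0}\right).$$ (i) The scheme preserves the discrete mass conservation law $\widetilde{\mathcal A}(\lambda,\nu)=D_m(\widetilde{F_1})+D_n(\widetilde{G_1})=0$ and also a discrete momentum conservation law: identically in the grid function $u$, $$\widetilde{\mathcal Q_2}\,\widetilde{\mathcal A}(\lambda,\nu)=D_m\widetilde{F_2}+D_n\widetilde{G_2},$$ where $\widetilde{\mathcal Q_2}=\mu_nu_{0,0}$, $$\widetilde{G_2}=\tfrac12u_{0,0}^2+\tfrac12u_{0,0}D_m^2\left(\lambda u_{-1,0}+\nu D_m^2u_{-2,0}\right),$$ and $$\begin{aligned}\widetilde{F_2}=\;&\tfrac13(\mu_nu_{0,0})(\mu_nu_{-1,0})(\mu_n\mu_mu_{-1,0})+\tfrac12\left\{(\mu_nu_{0,0})(D_m^2\mu_nu_{-2,0})+(\mu_nu_{-1,0})(D_m^2\mu_nu_{-1,0})\right\}\\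 &-\tfrac12(D_m\mu_nu_{-1,0})^2+\lambda\left\{(\mu_m\mu_nu_{-1,0})(D_nD_mu_{-1,0})-\tfrac12D_n\big[(\mu_mu_{-1,0})(D_mu_{-1,0})\big]\right\}\\ &+\nu\Big\{(\mu_nu_{0,0})(D_nD_m^3u_{-2,0})-(D_m\mu_nu_{-1,0})(D_nD_m^2u_{-1,0})\\ &\qquad+\tfrac12D_n\big[(D_mu_{-1,0})(D_m^2u_{-1,0})-u_{0,0}\,(D_m^3u_{-2,0})\big]\Big\}.\end{aligned}$$ (ii) If $\lambda$ and $\nu$ are functions of $(\Delta x,\Delta t)$ that are $\mathcal O(\Delta x^2)+\mathcal O(\Delta t^2)$, then $\widetilde{\mathcal A}(\lambda,\nu)$ and $\widetilde{\mathcal Q_2}$ are second-order accurate approximations, at the centre $(x_0,t_0+\Delta t/2)$ of the stencil, of $\mathcal A=u_t+uu_x+u_{xxx}$ and of $\mathcal Q_2=u$ respectively; that is, when $u_{i,j}=u(x_i,t_j)$ for a smooth function $u$, the differences $\widetilde{\mathcal A}(\lambda,\nu)-\mathcal A$ and $\widetilde{\mathcal Q_2}-\mathcal Q_2$ at that point are $\mathcal O(\Delta x^2)+\mathcal O(\Delta t^2)$.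
   Context: Discrete setting: a uniform grid with stepsizes $\Delta x,\Delta t$. Relative to a generic lattice point $(m,n)\in\mathbb{Z}^2$, the grid points are $x_i=x(m)+i\Delta x$, $t_j=t(n)+j\Delta t$, and $u_{i,j}$ denotes the value of the grid function at $(x_i,t_j)$. The forward shifts are $S_m:u_{i,j}\mapsto u_{i+1,j}$ and $S_n:u_{i,j}\mapsto u_{i,j+1}$, extended to functions of finitely many $u_{i,j}$. With $I$ the identity, $$D_m=\tfrac1{\Delta x}(S_m-I),\quad \mu_m=\tfrac12(S_m+I),\quad D_n=\tfrac1{\Delta t}(S_n-I),\quad \mu_n=\tfrac12(S_n+I);$$ these operators commute. An operator written to the left of a variable acts on that variable only; an operator written to the left of a bracket acts on the whole bracketed expression. A scheme $\widetilde{\mathcal A}=0$ preserves a discrete conservation law with characteristic $\widetilde{\mathcal Q}$ if $\widetilde{\mathcal Q}\widetilde{\mathcal A}=D_m(\widetilde F)+D_n(\widetilde G)$ identically, for some functions $\widetilde F,\widetilde G$ of finitely many shifts of $u_{0,0}$. The continuous KdV mass and momentum conservation laws have characteristics $1$ and $\mathcal Q_2=u$ and are $D_t(u)+D_x(\frac12u^2+u_{xx})=0$ and $D_t(\frac12u^2)+D_x(\frac13u^3+uu_{xx}-\frac12u_x^2)=0$. *)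

theory Defs
  imports "HOL-Analysis.Analysis"
begin

text \<open>
  A function of the shifts of \<open>u\<^bsub>0,0\<^esub>\<close> is a functional of the grid function \<open>u\<close>, where \<open>u i j\<close> is the
  value at the grid point with indices \<open>(i, j)\<close> relative to the generic lattice point. Evaluating
  such a functional elsewhere on the lattice is evaluating it on a shifted grid function, so an
  identity that holds for all \<open>u\<close> holds at every lattice point. In what follows, \<open>h\<close> and \<open>k\<close> are the
  stepsizes \<open>\<Delta>x\<close> and \<open>\<Delta>t\<close>.
\<close>

type_synonym grid_fun = "int \<Rightarrow> int \<Rightarrow> real"
type_synonym expr = "grid_fun \<Rightarrow> real"

definition U :: "int \<Rightarrow> int \<Rightarrow> expr" where
  "U i j = (\<lambda>u. u i j)"

definition finite_stencil :: "expr \<Rightarrow> bool" where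
  "finite_stencil F \<longleftrightarrow>
     (\<exists>K. finite K \<and> (\<forall>u v. (\<forall>(i, j)\<in>K. u i j = v i j) \<longrightarrow> F u = F v))"

definition Sm :: "expr \<Rightarrow> expr" where
  "Sm F = (\<lambda>u. F (\<lambda>i j. u (i + 1) j))"

definition Sn :: "expr \<Rightarrow> expr" where
  "Sn F = (\<lambda>u. F (\<lambda>i j. u i (j + 1)))"

definition Dm :: "real \<Rightarrow> expr \<Rightarrow> expr" where
  "Dm h F = (\<lambda>u. (Sm F u - F u) / h)"

definition Dn :: "real \<Rightarrow> expr \<Rightarrow> expr" where
  "Dn k F = (\<lambda>u. (Sn F u - F u) / k)"

definition \<mu>m :: "expr \<Rightarrow> expr" where
  "\<mu>m F = (\<lambda>u. (Sm F u + F u) / 2)"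

definition \<mu>n :: "expr \<Rightarrow> expr" where
  "\<mu>n F = (\<lambda>u. (Sn F u + F u) / 2)"

text \<open>
  The scheme \<open>A = 0\<close> preserves the discrete conservation law \<open>D\<^sub>m F + D\<^sub>n G = 0\<close> with characteristic \<open>Q\<close>.
\<close>

definition preserves_dcl :: "real \<Rightarrow> real \<Rightarrow> expr \<Rightarrow> expr \<Rightarrow> expr \<Rightarrow> expr \<Rightarrow> bool" where
  "preserves_dcl h k A Q F G \<longleftrightarrow>
     finite_stencil F \<and> finite_stencil G \<and> (\<forall>u. Q u * A u = Dm h F u + Dn k G u)"

definition G1 :: expr where
  "G1 = U 0 0"

definition F1 :: "real \<Rightarrow> real \<Rightarrow> real \<Rightarrow> real \<Rightarrow> expr" where
  "F1 h k lam nu = (\<lambda>u.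
     ((\<mu>n (U (-1) 0) u)\<^sup>2 + (\<mu>n (U 0 0) u)\<^sup>2 + \<mu>n (U (-1) 0) u * \<mu>n (U 0 0) u) / 6
     + \<mu>n (Dm h (Dm h (\<mu>m (U (-2) 0)))) u
     + Dn k (Dm h (\<lambda>v. lam * U (-1) 0 v + nu * Dm h (Dm h (U (-2) 0)) v)) u)"

definition scheme :: "real \<Rightarrow> real \<Rightarrow> real \<Rightarrow> real \<Rightarrow> expr" where
  "scheme h k lam nu = (\<lambda>u. Dm h (F1 h k lam nu) u + Dn k G1 u)"

definition Q2 :: expr where
  "Q2 = \<mu>n (U 0 0)"

definition G2 :: "real \<Rightarrow> real \<Rightarrow> real \<Rightarrow> expr" where
  "G2 h lam nu = (\<lambda>u.
     1/2 * (U 0 0 u)\<^sup>2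
     + 1/2 * U 0 0 u
         * Dm h (Dm h (\<lambda>v. lam * U (-1) 0 v + nu * Dm h (Dm h (U (-2) 0)) v)) u)"

definition F2 :: "real \<Rightarrow> real \<Rightarrow> real \<Rightarrow> real \<Rightarrow> expr" where
  "F2 h k lam nu = (\<lambda>u.
     1/3 * \<mu>n (U 0 0) u * \<mu>n (U (-1) 0) u * \<mu>n (\<mu>m (U (-1) 0)) u
     + 1/2 * (\<mu>n (U 0 0) u * Dm h (Dm h (\<mu>n (U (-2) 0))) u
              + \<mu>n (U (-1) 0) u * Dm h (Dm h (\<mu>n (U (-1) 0))) u)
     - 1/2 * (Dm h (\<mu>n (U (-1) 0)) u)\<^sup>2
     + lam * (\<mu>m (\<mu>n (U (-1) 0)) u * Dn k (Dm h (U (-1) 0)) u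
              - 1/2 * Dn k (\<lambda>v. \<mu>m (U (-1) 0) v * Dm h (U (-1) 0) v) u)
     + nu * (\<mu>n (U 0 0) u * Dn k (Dm h (Dm h (Dm h (U (-2) 0)))) u
             - Dm h (\<mu>n (U (-1) 0)) u * Dn k (Dm h (Dm h (U (-1) 0))) u
             + 1/2 * Dn k (\<lambda>v. Dm h (U (-1) 0) v * Dm h (Dm h (U (-1) 0)) v
                               - U 0 0 v * Dm h (Dm h (Dm h (U (-2) 0))) v) u))"

definition px :: "(real \<Rightarrow> real \<Rightarrow> real) \<Rightarrow> real \<Rightarrow> real \<Rightarrow> real" where
  "px u = (\<lambda>x t. deriv (\<lambda>y. u y t) x)"

definition pt :: "(real \<Rightarrow> real \<Rightarrow> real) \<Rightarrow> real \<Rightarrow> real \<Rightarrow> real" where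
  "pt u = (\<lambda>x t. deriv (\<lambda>s. u x s) t)"

text \<open>For open \<open>W\<close>: all iterated partial derivatives of order at most \<open>r\<close> exist and are continuous.\<close>

primrec Cr_on :: "nat \<Rightarrow> (real \<times> real) set \<Rightarrow> (real \<Rightarrow> real \<Rightarrow> real) \<Rightarrow> bool" where
  "Cr_on 0 W u \<longleftrightarrow> continuous_on W (\<lambda>(x, t). u x t)"
| "Cr_on (Suc r) W u \<longleftrightarrow>
     continuous_on W (\<lambda>(x, t). u x t) \<and>
     (\<forall>(x, t)\<in>W. (\<lambda>y. u y t) differentiable (at x) \<and> (\<lambda>s. u x s) differentiable (at t)) \<and>
     Cr_on r W (px u) \<and> Cr_on r W (pt u)"

definition smooth_on :: "(real \<times> real) set \<Rightarrow> (real \<Rightarrow> real \<Rightarrow> real) \<Rightarrow> bool" where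
  "smooth_on W u \<longleftrightarrow> (\<forall>r. Cr_on r W u)"

definition kdv :: "(real \<Rightarrow> real \<Rightarrow> real) \<Rightarrow> real \<Rightarrow> real \<Rightarrow> real" where
  "kdv u = (\<lambda>x t. pt u x t + u x t * px u x t + px (px (px u)) x t)"

definition sample ::
    "(real \<Rightarrow> real \<Rightarrow> real) \<Rightarrow> real \<Rightarrow> real \<Rightarrow> real \<Rightarrow> real \<Rightarrow> grid_fun" where
  "sample u x0 t0 h k = (\<lambda>i j. u (x0 + of_int i * h) (t0 + of_int j * k))"

text \<open>
  \<open>e(h, k) = O(h\<^sup>2) + O(k\<^sup>2)\<close> as \<open>h, k\<close> tend to \<open>0\<close> from above, independently of one another.
\<close>

definition second_order :: "(real \<Rightarrow> real \<Rightarrow> real) \<Rightarrow> bool" where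
  "second_order e \<longleftrightarrow>
     (\<exists>a b. (\<forall>h k. e h k = a h k + b h k) \<and>
        (\<lambda>(h, k). a h k) \<in> O[at_right 0 \<times>\<^sub>F at_right 0](\<lambda>(h, k). h\<^sup>2) \<and>
        (\<lambda>(h, k). b h k) \<in> O[at_right 0 \<times>\<^sub>F at_right 0](\<lambda>(h, k). k\<^sup>2))"

end

(*
  Every difference operator is division by h or k, so the discrete conservation laws are
  polynomial identities in 1/h, 1/k, lam, nu and the grid values.

  For the order of accuracy, the scheme is regrouped into averages over the two time levels
  t0, t0 + k of central differences in x at x0: each of these is O(h^2) from its x-derivative,
  and averaging over the two levels costs O(k^2). The factors of lam and nu are time difference
  quotients of central x-differences; the mean value theorem in t turns them into x-differences
  of u_t, which are bounded, so no interchange of mixed partial derivatives is needed.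
*)

theory Submission
  imports Defs "HOL-Library.Landau_Symbols"
begin

section \<open>Discrete conservation laws and the scheme as a sum of central differences\<close>

lemmas expr_defs = U_def Sm_def Sn_def Dm_def Dn_def \<mu>m_def \<mu>n_def

text \<open>Any finite stencil may be enlarged to a square, so the shifts that actually occur need
  not be listed.\<close>

lemma finite_stencilI:
  assumes "\<And>u v. (\<And>i j. \<bar>i\<bar> \<le> N \<Longrightarrow> \<bar>j\<bar> \<le> N \<Longrightarrow> u i j = v i j) \<Longrightarrow> F u = F v"
  shows "finite_stencil F"
  unfolding finite_stencil_def
proof (intro exI conjI allI impI)
  show "finite ({-N..N} \<times> {-N..N})" by simp
  show "F u = F v" if "\<forall>(i, j)\<in>{-N..N} \<times> {-N..N}. u i j = v i j" for u v
    by (rule assms) (use that in \<open>auto simp: abs_le_iff\<close>)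
qed

lemma finite_stencil_schemes:
  "finite_stencil (F1 h k lam nu)" "finite_stencil G1" "finite_stencil (F2 h k lam nu)" "finite_stencil (G2 h lam nu)"
  \<comment> \<open>The offsets that occur satisfy \<open>-2 \<le> i \<le> 2\<close> and
    \<open>0 \<le> j \<le> 1\<close>, so the square with \<open>N = 3\<close> contains them
    all.\<close>
  by (rule finite_stencilI[where N = 3]; simp add: F1_def G1_def F2_def G2_def expr_defs)+

lemma momentum_identity:
  "Q2 u * scheme h k lam nu u = Dm h (F2 h k lam nu) u + Dn k (G2 h lam nu) u"
proof -
  \<comment> \<open>Hiding the reciprocals keeps \<open>field_simps\<close> from splitting on \<open>h = 0\<close> and \<open>k = 0\<close>.\<close>
  define r s where "r = 1 / h" and "s = 1 / k"
  have d: "\<And>x. x / h = x * r" "\<And>x. x / k = x * s"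
    by (auto simp: r_def s_def field_simps power_one_over)
  show ?thesis
    unfolding scheme_def F1_def G1_def F2_def G2_def Q2_def expr_defs d
    by (simp add: field_simps power2_eq_square)
qed

text \<open>With \<open>a i\<close> the mean of \<open>u i 0\<close> and \<open>u i 1\<close>, the
  x-difference of the quadratic part of the flux factors as \<open>(a 1 - a (-1)) / (2 * h)\<close>
  times the three-point mean \<open>(a (-1) + a 0 + a 1) / 3\<close>. The latter is written as
  \<open>a 0\<close> plus a multiple of a second difference, so that every piece has a direct Taylor
  estimate.\<close>

lemma scheme_eq:
  fixes u :: grid_fun and h k :: real
  defines "w \<equiv> \<lambda>i. (u i 1 - u i 0) / k"
    and "avg \<equiv> \<lambda>j. (u 1 j + u (-1) j) / 2"
    and "d1 \<equiv> \<lambda>j. (u 1 j - u (-1) j) / (2 * h)"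
    and "d3 \<equiv> \<lambda>j. (u 2 j - 2 * u 1 j + 2 * u (-1) j - u (-2) j) / (2 * h ^ 3)"
  shows "scheme h k lam nu u =
    w 0 + (d1 0 + d1 1) / 2 * ((u 0 0 + u 0 1) / 2 + 1 / 3 * ((avg 0 - u 0 0) + (avg 1 - u 0 1)))
    + (d3 0 + d3 1) / 2
    + lam * ((w 1 - 2 * w 0 + w (-1)) / h\<^sup>2)
    + nu * ((w 2 - 4 * w 1 + 6 * w 0 - 4 * w (-1) + w (-2)) / h ^ 4)"
proof -
  define r s where "r = 1 / h" and "s = 1 / k"
  \<comment> \<open>Both sides vanish when the divisor is 0, so the regrouping is an identity for
    all \<open>h\<close> and \<open>k\<close> and can later be rewritten under a function of the
    steps.\<close>
  have d: "\<And>x. x / h = x * r" "\<And>x. x / k = x * s" "\<And>x. x / h ^ 2 = x * r ^ 2" "\<And>x. x / h ^ 4 = x * r ^ 4"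
     "\<And>x. x / (2 * h ^ 3) = x * r ^ 3 / 2" "\<And>x. x / (2 * h) = x * r / 2"
    by (auto simp: r_def s_def field_simps power_one_over)
  show ?thesis
    unfolding w_def avg_def d1_def d3_def scheme_def F1_def G1_def expr_defs d
    by (simp add: field_simps power2_eq_square power3_eq_cube power4_eq_xxxx)
qed

section \<open>Asymptotics in two independent stepsizes\<close>

abbreviation steps :: "(real \<times> real) filter" where
  "steps \<equiv> at_right 0 \<times>\<^sub>F at_right 0"

abbreviation step_sq :: "real \<times> real \<Rightarrow> real" where
  "step_sq \<equiv> \<lambda>p. (fst p)\<^sup>2 + (snd p)\<^sup>2"

lemma eventually_steps:
  assumes "a > 0"
  shows "\<forall>\<^sub>F p in steps. 0 < fst p \<and> fst p < a \<and> 0 < snd p \<and> snd p < a"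
proof -
  have *: "\<forall>\<^sub>F h in at_right 0. 0 < h \<and> h < a"
    using eventually_at_right_real[OF assms] by simp
  show ?thesis
    using eventually_prodI[OF * *] by (rule eventually_mono) auto
qed

lemma bigo_stepsI:
  fixes f g :: "real \<times> real \<Rightarrow> real"
  assumes "a > 0"
    and "\<And>h k. \<lbrakk>0 < h; h < a; 0 < k; k < a\<rbrakk> \<Longrightarrow> \<bar>f (h, k)\<bar> \<le> C * \<bar>g (h, k)\<bar>"
  shows "f \<in> O[steps](g)"
  by (rule bigoI[where c = C], rule eventually_mono[OF eventually_steps[OF assms(1)]])
     (use assms(2) in \<open>auto simp: split_paired_all\<close>)

text \<open>Replaces the two separate error terms by the single gauge
  \<open>h\<^sup>2 + k\<^sup>2\<close>, for which the Landau calculus is available. Each square is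
  at most the sum; conversely, an error bounded by the sum is divided in the proportion of the two
  squares.\<close>

lemma second_order_iff_bigo:
  "second_order e \<longleftrightarrow> (\<lambda>p. e (fst p) (snd p)) \<in> O[steps](step_sq)"
proof
  assume "second_order e"
  then obtain a b where e: "\<And>h k. e h k = a h k + b h k"
    and a: "(\<lambda>(h, k). a h k) \<in> O[steps](\<lambda>(h, k). h\<^sup>2)"
    and b: "(\<lambda>(h, k). b h k) \<in> O[steps](\<lambda>(h, k). k\<^sup>2)"
    unfolding second_order_def by blast
  have "(\<lambda>(h, k). h\<^sup>2) \<in> O[steps](step_sq)" "(\<lambda>(h, k). k\<^sup>2) \<in> O[steps](step_sq)"
    by (rule bigo_stepsI[where a = 1 and C = 1]; simp)+
  from sum_in_bigo(1)[OF landau_o.big_trans[OF a this(1)] landau_o.big_trans[OF b this(2)]]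
  show "(\<lambda>p. e (fst p) (snd p)) \<in> O[steps](step_sq)"
    by (simp add: e case_prod_beta)
next
  assume "(\<lambda>p. e (fst p) (snd p)) \<in> O[steps](step_sq)"
  then obtain C where C: "C > 0" "\<forall>\<^sub>F p in steps. \<bar>e (fst p) (snd p)\<bar> \<le> C * step_sq p"
    by (auto elim: landau_o.bigE)
  define b where "b = (\<lambda>h k. e h k * (k\<^sup>2 / (h\<^sup>2 + k\<^sup>2)))"
  \<comment> \<open>Taking the complement of \<open>b\<close> makes \<open>e = a + b\<close> hold
    everywhere, even at \<open>h = k = 0\<close> where the weights are 0; \<open>a_eq\<close>
    recovers the weighted form for positive \<open>h\<close>.\<close>
  define a where "a = (\<lambda>h k. e h k - b h k)"
  \<comment> \<open>One estimate serves both parts: \<open>z\<close> is \<open>h\<^sup>2\<close> for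
    \<open>a\<close> and \<open>k\<^sup>2\<close> for \<open>b\<close>.\<close>
  have bound: "\<bar>e h k * (z / (h\<^sup>2 + k\<^sup>2))\<bar> \<le> C * z"
    if "\<bar>e h k\<bar> \<le> C * (h\<^sup>2 + k\<^sup>2)" "0 < h" "0 \<le> z" for h k z :: real
  proof -
    have "h\<^sup>2 + k\<^sup>2 > 0" using that by (simp add: add_pos_nonneg)
    then have "\<bar>e h k\<bar> / (h\<^sup>2 + k\<^sup>2) \<le> C"
      using that by (simp add: pos_divide_le_eq)
    from mult_right_mono[OF this \<open>0 \<le> z\<close>] show ?thesis
      using \<open>0 \<le> z\<close> \<open>h\<^sup>2 + k\<^sup>2 > 0\<close> by (simp add: abs_mult)
  qed
  have a_eq: "a h k = e h k * (h\<^sup>2 / (h\<^sup>2 + k\<^sup>2))" if "0 < h" for h k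
  proof -
    have "h\<^sup>2 + k\<^sup>2 \<noteq> 0" using that by (simp add: sum_power2_eq_zero_iff)
    then have "h\<^sup>2 / (h\<^sup>2 + k\<^sup>2) = 1 - k\<^sup>2 / (h\<^sup>2 + k\<^sup>2)"
      unfolding eq_diff_eq add_divide_distrib[symmetric] by (rule divide_self)
    then show ?thesis unfolding a_def b_def by (simp add: right_diff_distrib)
  qed
  have "\<forall>\<^sub>F p in steps. norm (case p of (h, k) \<Rightarrow> a h k) \<le> C * norm (case p of (h, k) \<Rightarrow> h\<^sup>2)"
    using C(2) eventually_steps[OF zero_less_one]
    by eventually_elim (auto simp: a_eq simp del: times_divide_eq_right intro!: bound)
  moreover have "\<forall>\<^sub>F p in steps. norm (case p of (h, k) \<Rightarrow> b h k) \<le> C * norm (case p of (h, k) \<Rightarrow> k\<^sup>2)"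
    using C(2) eventually_steps[OF zero_less_one]
    by eventually_elim (auto simp: b_def simp del: times_divide_eq_right intro!: bound)
  ultimately show "second_order e"
    unfolding second_order_def by (intro exI[of _ a] exI[of _ b]) (auto simp: a_def intro!: bigoI)
qed

section \<open>Taylor estimates for differences in one variable\<close>

text \<open>\<open>d i\<close> is the \<open>i\<close>-th derivative of \<open>d 0\<close> within distance \<open>r\<close> of \<open>c\<close>, and \<open>M\<close> bounds \<open>d n\<close> there.\<close>

definition has_derivs :: "nat \<Rightarrow> real \<Rightarrow> real \<Rightarrow> real \<Rightarrow> (nat \<Rightarrow> real \<Rightarrow> real) \<Rightarrow> bool" where
  "has_derivs n c r M d \<longleftrightarrow>
     (\<forall>i<n. \<forall>y. \<bar>y - c\<bar> \<le> r \<longrightarrow> (d i has_real_derivative d (Suc i) y) (at y)) \<and>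
     (\<forall>y. \<bar>y - c\<bar> \<le> r \<longrightarrow> \<bar>d n y\<bar> \<le> M)"

text \<open>Lagrange's form of the remainder, bounded through \<open>M\<close>. Two one-sided
  inequalities are stated instead of an absolute value because the estimates below arise as linear
  combinations of them, with \<open>s\<close> of either sign.\<close>

lemma has_derivs_taylor:
  assumes "has_derivs n c r M d" "s \<in> {-r..r}"
  shows "d 0 (c + s) - (\<Sum>i<n. d i c / fact i * s ^ i) \<le> M / fact n * \<bar>s\<bar> ^ n"
    and "(\<Sum>i<n. d i c / fact i * s ^ i) - d 0 (c + s) \<le> M / fact n * \<bar>s\<bar> ^ n"
proof -
  have "\<exists>t. \<bar>t\<bar> \<le> \<bar>s\<bar> \<and> d 0 (c + s) =
      (\<Sum>i<n. d i (c + 0) / fact i * s ^ i) + d n (c + t) / fact n * s ^ n"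
  proof (rule Maclaurin_bi_le[where diff = "\<lambda>i t. d i (c + t)"], simp, intro allI impI)
    fix m t assume "m < n \<and> \<bar>t\<bar> \<le> \<bar>s\<bar>"
    then have "(d m has_real_derivative d (Suc m) (c + t)) (at (c + t))"
      using assms by (auto simp: has_derivs_def)
    then show "((\<lambda>t. d m (c + t)) has_real_derivative d (Suc m) (c + t)) (at t)"
      by (rule DERIV_cong[OF DERIV_chain2]) (auto intro!: derivative_eq_intros)
  qed
  then obtain t where t: "\<bar>t\<bar> \<le> \<bar>s\<bar>"
    "d 0 (c + s) - (\<Sum>i<n. d i c / fact i * s ^ i) = d n (c + t) / fact n * s ^ n"
    by auto
  have "\<bar>d n (c + t)\<bar> \<le> M"
    using assms t(1) by (auto simp: has_derivs_def)
  then have "\<bar>d 0 (c + s) - (\<Sum>i<n. d i c / fact i * s ^ i)\<bar> \<le> M / fact n * \<bar>s\<bar> ^ n"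
    unfolding t(2) by (simp add: abs_mult power_abs divide_right_mono mult_right_mono)
  then show "d 0 (c + s) - (\<Sum>i<n. d i c / fact i * s ^ i) \<le> M / fact n * \<bar>s\<bar> ^ n"
    and "(\<Sum>i<n. d i c / fact i * s ^ i) - d 0 (c + s) \<le> M / fact n * \<bar>s\<bar> ^ n"
    by linarith+
qed

text \<open>The linear terms at \<open>s\<close> and \<open>- s\<close> cancel, and each remainder
  is at most \<open>M * s\<^sup>2 / 2\<close>.\<close>

lemma second_difference:
  assumes "has_derivs 2 c r M d" "0 < s" "s \<le> r"
  shows "\<bar>d 0 (c + s) - 2 * d 0 c + d 0 (c - s)\<bar> \<le> M * s\<^sup>2"
  using has_derivs_taylor[OF assms(1), of s] has_derivs_taylor[OF assms(1), of "- s"] assms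
  by (simp add: eval_nat_numeral abs_le_iff algebra_simps; (intro conjI)?; linarith)

text \<open>The error is half of a second difference; the factor 1/2 is given away.\<close>

lemma midpoint_average:
  assumes "has_derivs 2 c r M d" "0 < s" "s \<le> r"
  shows "\<bar>(d 0 (c + s) + d 0 (c - s)) / 2 - d 0 c\<bar> \<le> M * s\<^sup>2"
proof -
  have "(d 0 (c + s) + d 0 (c - s)) / 2 - d 0 c = (d 0 (c + s) - 2 * d 0 c + d 0 (c - s)) / 2"
    by simp
  moreover have "\<bar>z / 2\<bar> \<le> \<bar>z\<bar>" for z :: real
    by simp
  ultimately show ?thesis
    using second_difference[OF assms] by (metis order_trans)
qed

text \<open>Even terms cancel. The two cubic remainders add up to at most
  \<open>M * s ^ 3 / 3\<close>, and division by \<open>2 * s\<close> leaves order two.\<close>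

lemma central_difference:
  assumes "has_derivs 3 c r M d" "0 < s" "s \<le> r"
  shows "\<bar>(d 0 (c + s) - d 0 (c - s)) / (2 * s) - d 1 c\<bar> \<le> M * s\<^sup>2"
proof -
  have "\<bar>d 0 (c + s) - d 0 (c - s) - 2 * s * d 1 c\<bar> \<le> M * s ^ 3"
    using has_derivs_taylor[OF assms(1), of s] has_derivs_taylor[OF assms(1), of "- s"] assms
    by (simp add: eval_nat_numeral abs_le_iff algebra_simps; (intro conjI)?; linarith)
  then show ?thesis
    using assms by (simp add: abs_le_iff field_simps eval_nat_numeral)
qed

text \<open>The weights 1, -2, 2, -1 are antisymmetric, which removes the even terms, and they also
  cancel the linear one; the cubic terms sum to \<open>2 * s ^ 3 * d 3 c\<close>. The remainders sum
  to \<open>(2 * 32 + 4) / 120\<close> times \<open>M * s ^ 5\<close>, a factor below 1.\<close>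

lemma third_difference:
  assumes "has_derivs 5 c r M d" "0 < s" "2 * s \<le> r"
  shows "\<bar>(d 0 (c + 2 * s) - 2 * d 0 (c + s) + 2 * d 0 (c - s) - d 0 (c - 2 * s)) / (2 * s ^ 3) - d 3 c\<bar>
    \<le> M * s\<^sup>2"
proof -
  have "\<bar>d 0 (c + 2 * s) - 2 * d 0 (c + s) + 2 * d 0 (c - s) - d 0 (c - 2 * s) - 2 * s ^ 3 * d 3 c\<bar>
    \<le> M * s ^ 5"
    using has_derivs_taylor[OF assms(1), of s] has_derivs_taylor[OF assms(1), of "- s"]
      has_derivs_taylor[OF assms(1), of "2 * s"] has_derivs_taylor[OF assms(1), of "- (2 * s)"] assms
    by (simp add: eval_nat_numeral abs_le_iff algebra_simps; (intro conjI)?; linarith)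
  then show ?thesis
    using assms by (simp add: abs_le_iff field_simps eval_nat_numeral)
qed

text \<open>The binomial weights annihilate polynomials of degree at most 3; the remainders
  contribute \<open>(2 * 16 + 8) / 24 = 5 / 3\<close>, rounded up to 2.\<close>

lemma fourth_difference:
  assumes "has_derivs 4 c r M d" "0 < s" "2 * s \<le> r"
  shows "\<bar>d 0 (c + 2 * s) - 4 * d 0 (c + s) + 6 * d 0 c - 4 * d 0 (c - s) + d 0 (c - 2 * s)\<bar>
    \<le> 2 * M * s ^ 4"
  using has_derivs_taylor[OF assms(1), of s] has_derivs_taylor[OF assms(1), of "- s"]
      has_derivs_taylor[OF assms(1), of "2 * s"] has_derivs_taylor[OF assms(1), of "- (2 * s)"] assms
    by (simp add: eval_nat_numeral abs_le_iff algebra_simps; (intro conjI)?; linarith)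

section \<open>Smooth functions of two variables\<close>

lemma smooth_on_px: "smooth_on W u \<Longrightarrow> smooth_on W (px u)"
  and smooth_on_pt: "smooth_on W u \<Longrightarrow> smooth_on W (pt u)"
  unfolding smooth_on_def by (metis Cr_on.simps(2))+

lemma smooth_on_funpow:
  assumes "smooth_on W u"
  shows "smooth_on W ((px ^^ i) u)" "smooth_on W ((pt ^^ i) u)"
  using assms by (induction i) (auto intro: smooth_on_px smooth_on_pt)

lemma smooth_on_continuous: "smooth_on W u \<Longrightarrow> continuous_on W (\<lambda>(x, t). u x t)"
  unfolding smooth_on_def by (metis Cr_on.simps(1))

lemma smooth_on_derivatives:
  assumes "smooth_on W u" "(x, t) \<in> W"
  shows "((\<lambda>y. u y t) has_real_derivative px u x t) (at x)"
    and "((\<lambda>s. u x s) has_real_derivative pt u x t) (at t)"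
proof -
  have "Cr_on (Suc 0) W u"
    using assms(1) by (simp add: smooth_on_def)
  then have "(\<lambda>y. u y t) differentiable (at x)" "(\<lambda>s. u x s) differentiable (at t)"
    using assms(2) by auto
  then show "((\<lambda>y. u y t) has_real_derivative px u x t) (at x)"
    and "((\<lambda>s. u x s) has_real_derivative pt u x t) (at t)"
    by (simp_all add: px_def pt_def DERIV_deriv_iff_real_differentiable)
qed

section \<open>Uniform error estimates on a compact box around the base point\<close>

locale grid_box =
  fixes W :: "(real \<times> real) set" and x0 t0 a :: real
  assumes a_pos: "a > 0"
    and box: "{x0 - a..x0 + a} \<times> {t0 - a..t0 + a} \<subseteq> W"
begin

lemma in_W: "\<bar>x - x0\<bar> \<le> a \<Longrightarrow> \<bar>t - t0\<bar> \<le> a \<Longrightarrow> (x, t) \<in> W"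
  using box by (auto simp: abs_le_iff)

lemma smooth_bounded:
  assumes "smooth_on W w"
  obtains M where "\<And>x t. \<bar>x - x0\<bar> \<le> a \<Longrightarrow> \<bar>t - t0\<bar> \<le> a \<Longrightarrow> \<bar>w x t\<bar> \<le> M"
proof -
  let ?B = "{x0 - a..x0 + a} \<times> {t0 - a..t0 + a}"
  have "compact ((\<lambda>(x, t). w x t) ` ?B)"
    by (intro compact_continuous_image compact_Times compact_Icc
        continuous_on_subset[OF smooth_on_continuous[OF assms] box])
  then obtain M where "\<forall>z\<in>(\<lambda>(x, t). w x t) ` ?B. \<bar>z\<bar> \<le> M"
    using compact_imp_bounded bounded_real by blast
  then show ?thesis
    by (intro that[of M]) (auto simp: abs_le_iff)
qed

text \<open>The bound is uniform in \<open>t\<close>: the same \<open>M\<close> serves both time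
  levels and the unknown intermediate times supplied by the mean value theorem.\<close>

lemma x_derivs:
  assumes "smooth_on W w"
  obtains M where "\<And>t. \<bar>t - t0\<bar> \<le> a \<Longrightarrow> has_derivs n x0 a M (\<lambda>i y. (px ^^ i) w y t)"
proof -
  obtain M where "\<And>x t. \<bar>x - x0\<bar> \<le> a \<Longrightarrow> \<bar>t - t0\<bar> \<le> a \<Longrightarrow> \<bar>(px ^^ n) w x t\<bar> \<le> M"
    using smooth_bounded[OF smooth_on_funpow(1)[OF assms]] by blast
  then show ?thesis
    by (intro that[of M])
       (auto simp: has_derivs_def intro: smooth_on_derivatives smooth_on_funpow assms in_W)
qed

text \<open>The centre \<open>c\<close> is free because the expansions in time are about
  \<open>t0 + k / 2\<close>, which moves with the step; \<open>M\<close> depends on neither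
  \<open>c\<close> nor \<open>r\<close>.\<close>

lemma t_derivs:
  assumes "smooth_on W w"
  obtains M where "\<And>c r. \<bar>c - t0\<bar> + r \<le> a \<Longrightarrow> has_derivs n c r M (\<lambda>i. (pt ^^ i) w x0)"
proof -
  obtain M where M: "\<And>x t. \<bar>x - x0\<bar> \<le> a \<Longrightarrow> \<bar>t - t0\<bar> \<le> a \<Longrightarrow> \<bar>(pt ^^ n) w x t\<bar> \<le> M"
    using smooth_bounded[OF smooth_on_funpow(2)[OF assms]] by blast
  have "has_derivs n c r M (\<lambda>i. (pt ^^ i) w x0)" if "\<bar>c - t0\<bar> + r \<le> a" for c r
  proof -
    have "\<bar>y - t0\<bar> \<le> a" if "\<bar>y - c\<bar> \<le> r" for y
      using that \<open>\<bar>c - t0\<bar> + r \<le> a\<close> by linarith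
    then show ?thesis
      using M[of x0] a_pos
      by (auto simp: has_derivs_def intro!: smooth_on_derivatives(2)[where W = W] smooth_on_funpow assms in_W)
  qed
  then show ?thesis by (rule that)
qed

text \<open>The stencil reaches \<open>x0 + 2 * h\<close>, \<open>x0 - 2 * h\<close> and
  \<open>t0 + k\<close>; steps below \<open>a / 2\<close> keep all of it inside the box.\<close>

lemma bigo_boxI:
  fixes f g :: "real \<times> real \<Rightarrow> real"
  assumes "\<And>h k. \<lbrakk>0 < h; 2 * h \<le> a; 0 < k; k \<le> a\<rbrakk> \<Longrightarrow> \<bar>f (h, k)\<bar> \<le> C * g (h, k)"
    and "\<And>p. g p \<ge> 0"
  shows "f \<in> O[steps](g)"
  by (rule bigo_stepsI[where a = "a / 2" and C = C]) (use assms a_pos in auto)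

text \<open>Covers the two kinds of error that occur: step \<open>h\<close> in space and half-step
  \<open>k / 2\<close> in time. The absolute value is taken because the sign of \<open>M\<close> is
  not recorded.\<close>

lemma step_sq_bound:
  fixes z :: real
  assumes "z \<le> M * h\<^sup>2 \<or> z \<le> M * (k / 2)\<^sup>2"
  shows "z \<le> \<bar>M\<bar> * step_sq (h, k)"
proof -
  have "M * h\<^sup>2 \<le> \<bar>M\<bar> * h\<^sup>2" "M / 4 * k\<^sup>2 \<le> \<bar>M\<bar> * k\<^sup>2"
    "0 \<le> \<bar>M\<bar> * h\<^sup>2" "0 \<le> \<bar>M\<bar> * k\<^sup>2"
    by (auto intro!: mult_right_mono simp del: times_divide_eq_left)
  moreover have "M * (k / 2)\<^sup>2 = M / 4 * k\<^sup>2"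
    by (simp add: power_divide)
  ultimately show ?thesis
    using assms unfolding fst_conv snd_conv distrib_left by (elim disjE) linarith+
qed

text \<open>The two time levels lie symmetrically about \<open>t0 + k / 2\<close> at distance
  \<open>k / 2\<close>, so this is a midpoint average.\<close>

lemma t_average:
  assumes "smooth_on W w"
  shows "(\<lambda>p. (w x0 t0 + w x0 (t0 + snd p)) / 2 - w x0 (t0 + snd p / 2)) \<in> O[steps](step_sq)"
proof -
  obtain M where M: "\<And>c r. \<bar>c - t0\<bar> + r \<le> a \<Longrightarrow> has_derivs 2 c r M (\<lambda>i. (pt ^^ i) w x0)"
    using t_derivs[OF assms] by blast
  show ?thesis
  proof (rule bigo_boxI[where C = "\<bar>M\<bar>"], rule step_sq_bound, rule disjI2)
    fix h k :: real assume "0 < k" "k \<le> a"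
    then show "\<bar>(w x0 t0 + w x0 (t0 + snd (h, k))) / 2 - w x0 (t0 + snd (h, k) / 2)\<bar> \<le> M * (k / 2)\<^sup>2"
      using midpoint_average[OF M[of "t0 + k / 2" "k / 2"], of "k / 2"] by (simp add: add.commute)
  qed simp
qed

text \<open>The one-step quotient is a central difference about \<open>t0 + k / 2\<close> with
  half-width \<open>k / 2\<close>, hence of second order.\<close>

lemma t_difference:
  assumes "smooth_on W w"
  shows "(\<lambda>p. (w x0 (t0 + snd p) - w x0 t0) / snd p - pt w x0 (t0 + snd p / 2)) \<in> O[steps](step_sq)"
proof -
  obtain M where M: "\<And>c r. \<bar>c - t0\<bar> + r \<le> a \<Longrightarrow> has_derivs 3 c r M (\<lambda>i. (pt ^^ i) w x0)"
    using t_derivs[OF assms] by blast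
  show ?thesis
  proof (rule bigo_boxI[where C = "\<bar>M\<bar>"], rule step_sq_bound, rule disjI2)
    fix h k :: real assume "0 < k" "k \<le> a"
    then show "\<bar>(w x0 (t0 + snd (h, k)) - w x0 t0) / snd (h, k) - pt w x0 (t0 + snd (h, k) / 2)\<bar>
        \<le> M * (k / 2)\<^sup>2"
      using central_difference[OF M[of "t0 + k / 2" "k / 2"], of "k / 2"] by (simp add: add.commute)
  qed simp
qed

text \<open>The parameter \<open>\<tau>\<close> selects the time level; the values 0 and 1 give
  \<open>t0\<close> and \<open>t0 + k\<close>.\<close>

lemma x_average:
  assumes "smooth_on W w" "0 \<le> \<tau>" "\<tau> \<le> 1"
  shows "(\<lambda>p. (w (x0 + fst p) (t0 + \<tau> * snd p) + w (x0 - fst p) (t0 + \<tau> * snd p)) / 2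
            - w x0 (t0 + \<tau> * snd p)) \<in> O[steps](step_sq)"
proof -
  obtain M where M: "\<And>t. \<bar>t - t0\<bar> \<le> a \<Longrightarrow> has_derivs 2 x0 a M (\<lambda>i y. (px ^^ i) w y t)"
    using x_derivs[OF assms(1)] by blast
  show ?thesis
  proof (rule bigo_boxI[where C = "\<bar>M\<bar>"], rule step_sq_bound, rule disjI1)
    fix h k :: real assume *: "0 < h" "2 * h \<le> a" "0 < k" "k \<le> a"
    have "\<tau> * k \<le> 1 * a" by (rule mult_mono) (use * assms in auto)
    with * assms show "\<bar>(w (x0 + fst (h, k)) (t0 + \<tau> * snd (h, k)) + w (x0 - fst (h, k)) (t0 + \<tau> * snd (h, k))) / 2
            - w x0 (t0 + \<tau> * snd (h, k))\<bar> \<le> M * h\<^sup>2"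
      using midpoint_average[OF M[of "t0 + \<tau> * k"], of h] by simp
  qed simp
qed

lemma x_difference:
  assumes "smooth_on W w" "0 \<le> \<tau>" "\<tau> \<le> 1"
  shows "(\<lambda>p. (w (x0 + fst p) (t0 + \<tau> * snd p) - w (x0 - fst p) (t0 + \<tau> * snd p)) / (2 * fst p)
            - px w x0 (t0 + \<tau> * snd p)) \<in> O[steps](step_sq)"
proof -
  obtain M where M: "\<And>t. \<bar>t - t0\<bar> \<le> a \<Longrightarrow> has_derivs 3 x0 a M (\<lambda>i y. (px ^^ i) w y t)"
    using x_derivs[OF assms(1)] by blast
  show ?thesis
  proof (rule bigo_boxI[where C = "\<bar>M\<bar>"], rule step_sq_bound, rule disjI1)
    fix h k :: real assume *: "0 < h" "2 * h \<le> a" "0 < k" "k \<le> a"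
    have "\<tau> * k \<le> 1 * a" by (rule mult_mono) (use * assms in auto)
    with * assms show "\<bar>(w (x0 + fst (h, k)) (t0 + \<tau> * snd (h, k)) - w (x0 - fst (h, k)) (t0 + \<tau> * snd (h, k)))
            / (2 * fst (h, k)) - px w x0 (t0 + \<tau> * snd (h, k))\<bar> \<le> M * h\<^sup>2"
      using central_difference[OF M[of "t0 + \<tau> * k"], of h] by simp
  qed simp
qed

lemma x_third_difference:
  assumes "smooth_on W w" "0 \<le> \<tau>" "\<tau> \<le> 1"
  shows "(\<lambda>p. (w (x0 + 2 * fst p) (t0 + \<tau> * snd p) - 2 * w (x0 + fst p) (t0 + \<tau> * snd p)
            + 2 * w (x0 - fst p) (t0 + \<tau> * snd p) - w (x0 - 2 * fst p) (t0 + \<tau> * snd p)) / (2 * fst p ^ 3)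
            - px (px (px w)) x0 (t0 + \<tau> * snd p)) \<in> O[steps](step_sq)"
proof -
  obtain M where M: "\<And>t. \<bar>t - t0\<bar> \<le> a \<Longrightarrow> has_derivs 5 x0 a M (\<lambda>i y. (px ^^ i) w y t)"
    using x_derivs[OF assms(1)] by blast
  show ?thesis
  proof (rule bigo_boxI[where C = "\<bar>M\<bar>"], rule step_sq_bound, rule disjI1)
    fix h k :: real assume *: "0 < h" "2 * h \<le> a" "0 < k" "k \<le> a"
    have "\<tau> * k \<le> 1 * a" by (rule mult_mono) (use * assms in auto)
    with * assms show "\<bar>(w (x0 + 2 * fst (h, k)) (t0 + \<tau> * snd (h, k)) - 2 * w (x0 + fst (h, k)) (t0 + \<tau> * snd (h, k))
            + 2 * w (x0 - fst (h, k)) (t0 + \<tau> * snd (h, k)) - w (x0 - 2 * fst (h, k)) (t0 + \<tau> * snd (h, k))) / (2 * fst (h, k) ^ 3)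
            - px (px (px w)) x0 (t0 + \<tau> * snd (h, k))\<bar> \<le> M * h\<^sup>2"
      using third_difference[OF M[of "t0 + \<tau> * k"], of h] by (simp add: numeral_3_eq_3)
  qed simp
qed

lemma has_real_derivative_pt:
  assumes "smooth_on W w" "\<bar>x - x0\<bar> \<le> a" "\<bar>t - t0\<bar> \<le> a"
  shows "((\<lambda>s. w x s) has_real_derivative pt w x t) (at t)"
  using assms by (intro smooth_on_derivatives[OF assms(1)] in_W)

text \<open>The mean value theorem is applied to the whole combination \<open>\<phi>\<close>, not
  term by term. This yields one common time \<open>t\<close> and leaves a second x-difference of
  \<open>pt w\<close>, which is bounded by a multiple of \<open>h\<^sup>2\<close>.\<close>

lemma t_x_second_difference:
  assumes "smooth_on W w"
  shows "(\<lambda>p. ((w (x0 + fst p) (t0 + snd p) - w (x0 + fst p) t0) / snd p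
            - 2 * ((w x0 (t0 + snd p) - w x0 t0) / snd p)
            + (w (x0 - fst p) (t0 + snd p) - w (x0 - fst p) t0) / snd p) / (fst p)\<^sup>2)
         \<in> O[steps](\<lambda>_. 1)"
proof -
  obtain M where M: "\<And>t. \<bar>t - t0\<bar> \<le> a \<Longrightarrow> has_derivs 2 x0 a M (\<lambda>i y. (px ^^ i) (pt w) y t)"
    using x_derivs[OF smooth_on_pt[OF assms]] by blast
  show ?thesis
  proof (rule bigo_boxI[where C = M])
    fix h k :: real assume *: "0 < h" "2 * h \<le> a" "0 < k" "k \<le> a"
    define \<phi> where "\<phi> = (\<lambda>v t :: real. v (x0 + h) t - 2 * v x0 t + v (x0 - h) t :: real)"
    have "\<exists>t. t0 < t \<and> t < t0 + k \<and> \<phi> w (t0 + k) - \<phi> w t0 = (t0 + k - t0) * \<phi> (pt w) t"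
      using * assms unfolding \<phi>_def
      by (intro MVT2) (auto intro!: derivative_eq_intros has_real_derivative_pt)
    then obtain t where t: "t0 < t" "t < t0 + k" "\<phi> w (t0 + k) - \<phi> w t0 = k * \<phi> (pt w) t"
      by auto
    have bound: "\<bar>\<phi> (pt w) t\<bar> \<le> M * h\<^sup>2"
      using second_difference[OF M[of t], of h] t * by (simp add: \<phi>_def)
    have "\<phi> (pt w) t = (\<phi> w (t0 + k) - \<phi> w t0) / k"
      using t(3) * by simp
    also have "\<dots> = (w (x0 + h) (t0 + k) - w (x0 + h) t0) / k
        - 2 * ((w x0 (t0 + k) - w x0 t0) / k) + (w (x0 - h) (t0 + k) - w (x0 - h) t0) / k"
      by (simp add: \<phi>_def add_divide_distrib diff_divide_distrib algebra_simps)
    finally show "\<bar>((w (x0 + fst (h, k)) (t0 + snd (h, k)) - w (x0 + fst (h, k)) t0) / snd (h, k)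
            - 2 * ((w x0 (t0 + snd (h, k)) - w x0 t0) / snd (h, k))
            + (w (x0 - fst (h, k)) (t0 + snd (h, k)) - w (x0 - fst (h, k)) t0) / snd (h, k))
            / (fst (h, k))\<^sup>2\<bar> \<le> M * 1"
      using bound * by (simp add: divide_le_eq)
  qed simp
qed

text \<open>As for the second difference: at one common intermediate time, the fourth x-difference
  of \<open>pt w\<close> absorbs the division by \<open>h ^ 4\<close>.\<close>

lemma t_x_fourth_difference:
  assumes "smooth_on W w"
  shows "(\<lambda>p. ((w (x0 + 2 * fst p) (t0 + snd p) - w (x0 + 2 * fst p) t0) / snd p
            - 4 * ((w (x0 + fst p) (t0 + snd p) - w (x0 + fst p) t0) / snd p)
            + 6 * ((w x0 (t0 + snd p) - w x0 t0) / snd p)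
            - 4 * ((w (x0 - fst p) (t0 + snd p) - w (x0 - fst p) t0) / snd p)
            + (w (x0 - 2 * fst p) (t0 + snd p) - w (x0 - 2 * fst p) t0) / snd p) / fst p ^ 4)
         \<in> O[steps](\<lambda>_. 1)"
proof -
  obtain M where M: "\<And>t. \<bar>t - t0\<bar> \<le> a \<Longrightarrow> has_derivs 4 x0 a M (\<lambda>i y. (px ^^ i) (pt w) y t)"
    using x_derivs[OF smooth_on_pt[OF assms]] by blast
  show ?thesis
  proof (rule bigo_boxI[where C = "2 * M"])
    fix h k :: real assume *: "0 < h" "2 * h \<le> a" "0 < k" "k \<le> a"
    define \<phi> where "\<phi> = (\<lambda>v t :: real. v (x0 + 2 * h) t - 4 * v (x0 + h) t + 6 * v x0 t
      - 4 * v (x0 - h) t + v (x0 - 2 * h) t :: real)"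
    have "\<exists>t. t0 < t \<and> t < t0 + k \<and> \<phi> w (t0 + k) - \<phi> w t0 = (t0 + k - t0) * \<phi> (pt w) t"
      using * assms unfolding \<phi>_def
      by (intro MVT2) (auto intro!: derivative_eq_intros has_real_derivative_pt)
    then obtain t where t: "t0 < t" "t < t0 + k" "\<phi> w (t0 + k) - \<phi> w t0 = k * \<phi> (pt w) t"
      by auto
    have bound: "\<bar>\<phi> (pt w) t\<bar> \<le> 2 * M * h ^ 4"
      using fourth_difference[OF M[of t], of h] t * by (simp add: \<phi>_def)
    have "\<phi> (pt w) t = (\<phi> w (t0 + k) - \<phi> w t0) / k"
      using t(3) * by simp
    also have "\<dots> = (w (x0 + 2 * h) (t0 + k) - w (x0 + 2 * h) t0) / k
            - 4 * ((w (x0 + h) (t0 + k) - w (x0 + h) t0) / k)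
            + 6 * ((w x0 (t0 + k) - w x0 t0) / k)
            - 4 * ((w (x0 - h) (t0 + k) - w (x0 - h) t0) / k)
            + (w (x0 - 2 * h) (t0 + k) - w (x0 - 2 * h) t0) / k"
      by (simp add: \<phi>_def add_divide_distrib diff_divide_distrib algebra_simps)
    finally show "\<bar>((w (x0 + 2 * fst (h, k)) (t0 + snd (h, k)) - w (x0 + 2 * fst (h, k)) t0) / snd (h, k)
            - 4 * ((w (x0 + fst (h, k)) (t0 + snd (h, k)) - w (x0 + fst (h, k)) t0) / snd (h, k))
            + 6 * ((w x0 (t0 + snd (h, k)) - w x0 t0) / snd (h, k))
            - 4 * ((w (x0 - fst (h, k)) (t0 + snd (h, k)) - w (x0 - fst (h, k)) t0) / snd (h, k))
            + (w (x0 - 2 * fst (h, k)) (t0 + snd (h, k)) - w (x0 - 2 * fst (h, k)) t0) / snd (h, k))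
            / fst (h, k) ^ 4\<bar> \<le> 2 * M * 1"
      using bound * by (simp add: divide_le_eq)
  qed simp
qed

lemma value_bounded:
  assumes "smooth_on W w"
  shows "(\<lambda>p. w x0 (t0 + snd p / 2)) \<in> O[steps](\<lambda>_. 1)"
proof -
  obtain M where "\<And>x t. \<bar>x - x0\<bar> \<le> a \<Longrightarrow> \<bar>t - t0\<bar> \<le> a \<Longrightarrow> \<bar>w x t\<bar> \<le> M"
    using smooth_bounded[OF assms] by blast
  then show ?thesis
    by (intro bigo_boxI[where C = M]) (use a_pos in auto)
qed

end

section \<open>Combining the estimates\<close>

text \<open>The error splits into the mean of the errors at the two levels plus the error of
  averaging the exact values \<open>a\<close> and \<open>b\<close>.\<close>

lemma mean_bigo:
  fixes f g :: "'a \<Rightarrow> real"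
  assumes "(\<lambda>p. f p - a p) \<in> O[F](e)" "(\<lambda>p. g p - b p) \<in> O[F](e)"
    and "(\<lambda>p. (a p + b p) / 2 - c p) \<in> O[F](e)"
  shows "(\<lambda>p. (f p + g p) / 2 - c p) \<in> O[F](e)"
proof -
  have "(\<lambda>p. 1 / 2 * ((f p - a p) + (g p - b p))) \<in> O[F](e)"
    using sum_in_bigo(1)[OF assms(1,2)] by (subst landau_o.big.cmult_in_iff) auto
  from sum_in_bigo(1)[OF this assms(3)]
  have "(\<lambda>p. 1 / 2 * ((f p - a p) + (g p - b p)) + ((a p + b p) / 2 - c p)) \<in> O[F](e)" .
  also have "(\<lambda>p. 1 / 2 * ((f p - a p) + (g p - b p)) + ((a p + b p) / 2 - c p))
      = (\<lambda>p. (f p + g p) / 2 - c p)"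
    by (simp add: fun_eq_iff field_simps)
  finally show ?thesis .
qed

text \<open>Uses \<open>f * g - a * b = (f - a) * g + (g - b) * a\<close>, where \<open>g\<close> is
  bounded because \<open>b\<close> and the gauge \<open>e\<close> are.\<close>

lemma product_bigo:
  fixes f g :: "'a \<Rightarrow> real"
  assumes "(\<lambda>p. f p - a p) \<in> O[F](e)" "(\<lambda>p. g p - b p) \<in> O[F](e)"
    and "a \<in> O[F](\<lambda>_. 1)" "b \<in> O[F](\<lambda>_. 1)" "e \<in> O[F](\<lambda>_. 1)"
  shows "(\<lambda>p. f p * g p - a p * b p) \<in> O[F](e)"
proof -
  have "(\<lambda>p. g p - b p) \<in> O[F](\<lambda>_. 1)"
    using assms(2,5) by (rule landau_o.big_trans)
  from sum_in_bigo(1)[OF this assms(4)] have "g \<in> O[F](\<lambda>_. 1)"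
    by simp
  from sum_in_bigo(1)[OF landau_o.big.mult[OF assms(1) this] landau_o.big.mult[OF assms(2,3)]]
  have "(\<lambda>p. (f p - a p) * g p + (g p - b p) * a p) \<in> O[F](e)"
    by simp
  also have "(\<lambda>p. (f p - a p) * g p + (g p - b p) * a p) = (\<lambda>p. f p * g p - a p * b p)"
    by (simp add: fun_eq_iff algebra_simps)
  finally show ?thesis .
qed

context grid_box
begin

lemma second_order_Q2:
  assumes "smooth_on W u"
  shows "second_order (\<lambda>h k. Q2 (sample u x0 t0 h k) - u x0 (t0 + k / 2))"
  using t_average[OF assms]
  by (simp add: second_order_iff_bigo Q2_def expr_defs sample_def add.commute)

lemma second_order_scheme:
  assumes u: "smooth_on W u" and lam: "second_order lam" and nu: "second_order nu"
  shows "second_order (\<lambda>h k. scheme h k (lam h k) (nu h k) (sample u x0 t0 h k) - kdv u x0 (t0 + k / 2))"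
proof -
  define v where "v = (\<lambda>p. sample u x0 t0 (fst p) (snd p))"
  define w where "w = (\<lambda>i p. (v p i 1 - v p i 0) / snd p)"
  define avg where "avg = (\<lambda>j p. (v p 1 j + v p (-1) j) / 2)"
  define d1 where "d1 = (\<lambda>j p. (v p 1 j - v p (-1) j) / (2 * fst p))"
  define d3 where "d3 = (\<lambda>j p. (v p 2 j - 2 * v p 1 j + 2 * v p (-1) j - v p (-2) j) / (2 * fst p ^ 3))"
  define Lam where "Lam = (\<lambda>p. (w 1 p - 2 * w 0 p + w (-1) p) / (fst p)\<^sup>2)"
  define Nu where "Nu = (\<lambda>p. (w 2 p - 4 * w 1 p + 6 * w 0 p - 4 * w (-1) p + w (-2) p) / fst p ^ 4)"
  \<comment> \<open>This is the three-point mean multiplying the central difference in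
    \<open>scheme_eq\<close>; it approximates \<open>u\<close> at the centre of the stencil.\<close>
  define uc where "uc = (\<lambda>p. (v p 0 0 + v p 0 1) / 2 + 1 / 3 * ((avg 0 p - v p 0 0) + (avg 1 p - v p 0 1)))"
  note defs = w_def avg_def d1_def d3_def Lam_def Nu_def v_def sample_def

  have "(\<lambda>p. w 0 p - pt u x0 (t0 + snd p / 2)) \<in> O[steps](step_sq)"
    using t_difference[OF u] by (simp add: defs)
  moreover have "(\<lambda>p. (d3 0 p + d3 1 p) / 2 - px (px (px u)) x0 (t0 + snd p / 2)) \<in> O[steps](step_sq)"
    using x_third_difference[OF u, of 0] x_third_difference[OF u, of 1]
    by (intro mean_bigo[OF _ _ t_average]) (auto simp: defs intro: smooth_on_px u)
  moreover have "(\<lambda>p. (d1 0 p + d1 1 p) / 2 * uc p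
      - px u x0 (t0 + snd p / 2) * u x0 (t0 + snd p / 2)) \<in> O[steps](step_sq)"
  proof (rule product_bigo)
    show "(\<lambda>p. (d1 0 p + d1 1 p) / 2 - px u x0 (t0 + snd p / 2)) \<in> O[steps](step_sq)"
      using x_difference[OF u, of 0] x_difference[OF u, of 1]
      by (intro mean_bigo[OF _ _ t_average]) (auto simp: defs intro: smooth_on_px u)
    have avg: "(\<lambda>p. avg 0 p - v p 0 0) \<in> O[steps](step_sq)" "(\<lambda>p. avg 1 p - v p 0 1) \<in> O[steps](step_sq)"
      using x_average[OF u, of 0] x_average[OF u, of 1] by (simp_all add: defs)
    have "(\<lambda>p. (v p 0 0 + v p 0 1) / 2 - u x0 (t0 + snd p / 2)) \<in> O[steps](step_sq)"
      using t_average[OF u] by (simp add: defs)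
    moreover have "(\<lambda>p. 1 / 3 * ((avg 0 p - v p 0 0) + (avg 1 p - v p 0 1))) \<in> O[steps](step_sq)"
      using sum_in_bigo(1)[OF avg] by (subst landau_o.big.cmult_in_iff) auto
    ultimately have "(\<lambda>p. ((v p 0 0 + v p 0 1) / 2 - u x0 (t0 + snd p / 2))
        + 1 / 3 * ((avg 0 p - v p 0 0) + (avg 1 p - v p 0 1))) \<in> O[steps](step_sq)"
      by (rule sum_in_bigo)
    then show "(\<lambda>p. uc p - u x0 (t0 + snd p / 2)) \<in> O[steps](step_sq)"
      by (simp add: uc_def algebra_simps)
    show "step_sq \<in> O[steps](\<lambda>_. 1)"
    proof (rule bigo_stepsI[where a = 1 and C = 2])
      fix h k :: real assume "0 < h" "h < 1" "0 < k" "k < 1"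
      then have "h\<^sup>2 \<le> 1" "k\<^sup>2 \<le> 1" by (auto simp: power_le_one)
      then show "\<bar>step_sq (h, k)\<bar> \<le> 2 * \<bar>1\<bar>" by simp
    qed simp
  qed (intro value_bounded smooth_on_px u)+
  \<comment> \<open>These factors are only bounded; the second order comes from the coefficients
    \<open>lam\<close> and \<open>nu\<close>.\<close>
  moreover have "Lam \<in> O[steps](\<lambda>_. 1)" "Nu \<in> O[steps](\<lambda>_. 1)"
    using t_x_second_difference[OF u] t_x_fourth_difference[OF u] by (simp_all add: defs)
  from landau_o.big.mult[OF lam[unfolded second_order_iff_bigo] this(1)]
    landau_o.big.mult[OF nu[unfolded second_order_iff_bigo] this(2)]
  have "(\<lambda>p. lam (fst p) (snd p) * Lam p) \<in> O[steps](step_sq)"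
    "(\<lambda>p. nu (fst p) (snd p) * Nu p) \<in> O[steps](step_sq)"
    by simp_all
  ultimately have "(\<lambda>p. (w 0 p - pt u x0 (t0 + snd p / 2))
      + ((d3 0 p + d3 1 p) / 2 - px (px (px u)) x0 (t0 + snd p / 2))
      + ((d1 0 p + d1 1 p) / 2 * uc p - px u x0 (t0 + snd p / 2) * u x0 (t0 + snd p / 2))
      + lam (fst p) (snd p) * Lam p + nu (fst p) (snd p) * Nu p) \<in> O[steps](step_sq)"
    by (intro sum_in_bigo(1))
  moreover have "scheme (fst p) (snd p) (lam (fst p) (snd p)) (nu (fst p) (snd p))
        (sample u x0 t0 (fst p) (snd p))
      = w 0 p + (d1 0 p + d1 1 p) / 2 * uc p + (d3 0 p + d3 1 p) / 2
        + lam (fst p) (snd p) * Lam p + nu (fst p) (snd p) * Nu p" for p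
    unfolding scheme_eq w_def d1_def d3_def avg_def uc_def Lam_def Nu_def v_def ..
  ultimately show ?thesis
    unfolding second_order_iff_bigo kdv_def
    by (simp add: algebra_simps)
qed

end

section \<open>Passage from an open domain to a box, and conclusion\<close>

lemma open_contains_box:
  fixes W :: "(real \<times> real) set"
  assumes "open W" "(x, t) \<in> W"
  obtains a where "a > 0" "{x - a..x + a} \<times> {t - a..t + a} \<subseteq> W"
proof -
  obtain A B where AB: "open A" "open B" "(x, t) \<in> A \<times> B" "A \<times> B \<subseteq> W"
    using open_prod_elim[OF assms] .
  obtain r s where "r > 0" "cball x r \<subseteq> A" "s > 0" "cball t s \<subseteq> B"
    using AB unfolding open_contains_cball by blast
  moreover have "{x - min r s..x + min r s} \<subseteq> cball x r" "{t - min r s..t + min r s} \<subseteq> cball t s"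
    by (auto simp: dist_real_def)
  ultimately have "{x - min r s..x + min r s} \<times> {t - min r s..t + min r s} \<subseteq> A \<times> B"
    by (meson Sigma_mono order_trans)
  with AB(4) \<open>r > 0\<close> \<open>s > 0\<close> show ?thesis
    by (intro that[of "min r s"]) (simp, rule order_trans)
qed

theorem mainTheorem3:
  shows
    "(\<forall>h k lam nu :: real. h > 0 \<longrightarrow> k > 0 \<longrightarrow>
        preserves_dcl h k (scheme h k lam nu) (\<lambda>_. 1) (F1 h k lam nu) G1 \<and>
        preserves_dcl h k (scheme h k lam nu) Q2 (F2 h k lam nu) (G2 h lam nu))
     \<and>
     (\<forall>(lam :: real \<Rightarrow> real \<Rightarrow> real) (nu :: real \<Rightarrow> real \<Rightarrow> real)
        (u :: real \<Rightarrow> real \<Rightarrow> real) (W :: (real \<times> real) set) (x0 :: real) (t0 :: real).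
        second_order lam \<longrightarrow> second_order nu \<longrightarrow>
        open W \<longrightarrow> (x0, t0) \<in> W \<longrightarrow> smooth_on W u \<longrightarrow>
        second_order (\<lambda>h k. scheme h k (lam h k) (nu h k) (sample u x0 t0 h k)
                            - kdv u x0 (t0 + k / 2)) \<and>
        second_order (\<lambda>h k. Q2 (sample u x0 t0 h k) - u x0 (t0 + k / 2)))"
  (is "?conservation \<and> ?accuracy")
proof
  \<comment> \<open>With characteristic 1, the mass law is the definition of
    \<open>scheme\<close>.\<close>
  show ?conservation
    unfolding preserves_dcl_def
    using finite_stencil_schemes momentum_identity by (simp add: scheme_def)
  show ?accuracy
  proof (intro allI impI)
    fix lam nu u :: "real \<Rightarrow> real \<Rightarrow> real" and W :: "(real \<times> real) set" and x0 t0 :: real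
    assume A: "second_order lam" "second_order nu" "open W" "(x0, t0) \<in> W" "smooth_on W u"
    obtain a where "a > 0" "{x0 - a..x0 + a} \<times> {t0 - a..t0 + a} \<subseteq> W"
      using open_contains_box[OF A(3,4)] .
    then interpret grid_box W x0 t0 a
      by unfold_locales
    show "second_order (\<lambda>h k. scheme h k (lam h k) (nu h k) (sample u x0 t0 h k)
                            - kdv u x0 (t0 + k / 2)) \<and>
        second_order (\<lambda>h k. Q2 (sample u x0 t0 h k) - u x0 (t0 + k / 2))"
      using second_order_scheme second_order_Q2 A by blast
  qed
qed

end
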